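(* Let $1\le m\le n$ be integers. There exists a uniform constant $C$, depending only on $n,m$, such that for every $\lambda=(\lambda_1,\dots,\lambda_n)\in\Gamma_m$ with $\lambda_1\ge\lambda_2\ge\cdots\ge\lambda_n$ the following inequalities hold. (a) For $1\le i\le m-1$, $$\frac{\lambda_1\cdots\lambda_m}{\lambda_i}\le C\,\big(S_{m-1;i}\,S_{m-1}\big)^{1/2}.$$ (b) For $1\le\ell\le n$ and every increasing multi-index $1\le i_1<\cdots<i_{m-1}\le n$ with $i_s\ne\ell$ for all $s=1,\dots,m-1$, $$\prod_{s=1}^{m-1}|\lambda_{i_s}|\le C\,\big(S_{m-1;\ell}\,S_{m-1}\big)^{1/2}.$$
   Context: $S_k(\lambda)=\sum_{1\le i_1<\cdots<i_k\le n}\lambda_{i_1}\cdots\lambda_{i_k}$ is the $k$-th elementary symmetric polynomial, with $S_0=1$ and $S_k=0$ for $k<0$ or $k>n$. $S_{k;i}(\lambda)$ denotes $S_k$ evaluated at $\lambda$ with $\lambda_i$ replaced by $0$. In the claim $S_{m-1}=S_{m-1}(\lambda)$ and $S_{m-1;i}=S_{m-1;i}(\lambda)$. $\Gamma_m=\{\lambda\in\mathbb R^n:S_1(\lambda)>0,\dots,S_m(\lambda)>0\}$. For $\lambda\in\Gamma_m$ in decreasing order one has $\lambda_m>0$ and $S_{m-1;i}>0$ for all $i$. *)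

theory Defs
  imports Complex_Main
begin

text \<open>
  A vector \<open>\<lambda> \<in> \<real>\<^sup>n\<close> is a function \<open>nat \<Rightarrow> real\<close>, of which only the values at the
  indices \<open>1, \<dots>, n\<close> are used.
\<close>

text \<open>
  The increasing index tuples of length \<open>k\<close> are the \<open>k\<close>-element subsets of \<open>{1..n}\<close>;
  the sum is 1 for \<open>k = 0\<close> and 0 for \<open>k > n\<close>.
\<close>
definition elem_sym :: "nat \<Rightarrow> nat \<Rightarrow> (nat \<Rightarrow> real) \<Rightarrow> real" where
  "elem_sym n k v = (\<Sum>I\<in>{I. I \<subseteq> {1..n} \<and> card I = k}. \<Prod>i\<in>I. v i)"

definition elem_sym_del :: "nat \<Rightarrow> nat \<Rightarrow> nat \<Rightarrow> (nat \<Rightarrow> real) \<Rightarrow> real" where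
  "elem_sym_del n k i v = elem_sym n k (v(i := 0))"

definition Gamma_cone :: "nat \<Rightarrow> nat \<Rightarrow> (nat \<Rightarrow> real) set" where
  "Gamma_cone n m = {v. \<forall>k\<in>{1..m}. elem_sym n k v > 0}"

end

theory Submission
  imports Defs
begin

text \<open>
  Everything rests on the inequality \<open>(k+1) S\<^sub>k\<^sub>-\<^sub>1 S\<^sub>k\<^sub>+\<^sub>1 \<le> k S\<^sub>k\<^sup>2\<close>, valid for all real vectors
  (\<open>newton_strict\<close>).  Its constant is weaker than Newton's but does not depend on the dimension, and
  what matters is that \<open>k/(k+1) < 1\<close>.  It has two consequences.

  The first is the classical fact that deleting an entry maps \<open>\<Gamma>\<^sub>m\<close> into \<open>\<Gamma>\<^sub>m\<^sub>-\<^sub>1\<close>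
  (\<open>pos_upto_delete\<close>).  Deleting the \<open>m-1\<close> largest entries of a vector in \<open>\<Gamma>\<^sub>m\<close> leaves entries with
  positive sum, so \<open>\<lambda>\<^sub>m > 0\<close> and \<open>\<bar>\<lambda>\<^sub>j\<bar> \<le> n \<lambda>\<^sub>m\<close> for \<open>j \<ge> m\<close>.

  The second is a dichotomy (\<open>sym_dichotomy\<close>).  Let \<open>P\<close> be the product of \<open>k\<close> positive entries of a
  vector in \<open>\<Gamma>\<^sub>k\<close>, all of them at least \<open>q\<close>.  Either \<open>S\<^sub>k\<close> is at least \<open>c P\<close>, or \<open>S\<^sub>k\<^sub>+\<^sub>1\<close> is at most
  \<open>-c P q\<close>: if cancellation makes \<open>S\<^sub>k\<close> small, then \<open>S\<^sub>k\<^sub>+\<^sub>1\<close> has to be very negative.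

  For \<open>\<lambda> \<in> \<Gamma>\<^sub>m\<close> let \<open>P\<close> be the product of any \<open>m-1\<close> positive entries avoiding the index \<open>\<ell>\<close>, and \<open>q\<close>
  the smallest of them.  Since \<open>S\<^sub>m > 0\<close>, the dichotomy gives \<open>S\<^sub>m\<^sub>-\<^sub>1 \<ge> c P\<close>.  Applied to \<open>\<lambda>\<close> without
  its entry \<open>\<lambda>\<^sub>\<ell>\<close>, it gives \<open>S\<^sub>m\<^sub>-\<^sub>1\<^sub>;\<^sub>\<ell> \<ge> c P\<close>, which is all that is needed, or \<open>S\<^sub>m\<^sub>;\<^sub>\<ell> \<le> -c P q\<close>.  In
  the latter case \<open>S\<^sub>m = \<lambda>\<^sub>\<ell> S\<^sub>m\<^sub>-\<^sub>1\<^sub>;\<^sub>\<ell> + S\<^sub>m\<^sub>;\<^sub>\<ell> > 0\<close> yields \<open>S\<^sub>m\<^sub>-\<^sub>1\<^sub>;\<^sub>\<ell> > c P q / \<lambda>\<^sub>\<ell>\<close>.  This loses a factor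
  \<open>\<lambda>\<^sub>\<ell> / q\<close>, but when \<open>\<lambda>\<^sub>\<ell> > q\<close> the factor \<open>S\<^sub>m\<^sub>-\<^sub>1\<close> wins it back: exchanging the entry \<open>q\<close> for \<open>\<lambda>\<^sub>\<ell>\<close>
  shows \<open>S\<^sub>m\<^sub>-\<^sub>1 \<ge> c P \<lambda>\<^sub>\<ell> / q\<close>.  So \<open>c\<^sup>2 P\<^sup>2 \<le> S\<^sub>m\<^sub>-\<^sub>1\<^sub>;\<^sub>\<ell> S\<^sub>m\<^sub>-\<^sub>1\<close> in all cases (\<open>prod_sq_le_sym_mult\<close>).
  Part (a) is the case of the entries \<open>1, \<dots>, m\<close> without \<open>i\<close>; for part (b), any product of \<open>m-1\<close>
  absolute values is at most \<open>n\<^sup>m\<^sup>-\<^sup>1\<close> times such a product of largest entries.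
\<close>

section \<open>Elementary symmetric functions over a finite index set\<close>

text \<open>
  Indexing by arbitrary finite sets turns the deletion of an entry into a set difference, so that
  deletions can be iterated.
\<close>
definition sym_on :: "'a set \<Rightarrow> nat \<Rightarrow> ('a \<Rightarrow> real) \<Rightarrow> real" where
  "sym_on A k v = (\<Sum>I | I \<subseteq> A \<and> card I = k. \<Prod>i\<in>I. v i)"

definition pos_upto :: "'a set \<Rightarrow> nat \<Rightarrow> ('a \<Rightarrow> real) \<Rightarrow> bool" where
  "pos_upto A m v \<longleftrightarrow> (\<forall>k\<in>{1..m}. sym_on A k v > 0)"

lemma pos_uptoD: "pos_upto A m v \<Longrightarrow> 1 \<le> k \<Longrightarrow> k \<le> m \<Longrightarrow> sym_on A k v > 0"
  by (auto simp: pos_upto_def)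

lemma sym_on_0 [simp]: "finite A \<Longrightarrow> sym_on A 0 v = 1"
proof -
  assume "finite A"
  then have "{I. I \<subseteq> A \<and> card I = 0} = {{}}"
    by (auto dest: finite_subset)
  then show ?thesis by (simp add: sym_on_def)
qed

lemma sym_on_empty_Suc [simp]: "sym_on {} (Suc k) v = 0"
proof -
  have "{I. I \<subseteq> ({} :: 'a set) \<and> card I = Suc k} = {}" by auto
  then show ?thesis by (simp add: sym_on_def)
qed

lemma sym_on_insert:
  assumes "finite A" "a \<notin> A"
  shows "sym_on (insert a A) (Suc k) v = v a * sym_on A k v + sym_on A (Suc k) v"
proof -
  let ?X = "{I. I \<subseteq> A \<and> card I = k}" and ?Y = "{I. I \<subseteq> A \<and> card I = Suc k}"
  have fin: "finite ?X" "finite ?Y" using assms by auto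
  have split: "{I. I \<subseteq> insert a A \<and> card I = Suc k} = insert a ` ?X \<union> ?Y" (is "?L = ?R")
  proof
    show "?L \<subseteq> ?R"
    proof
      fix I assume I: "I \<in> ?L"
      show "I \<in> ?R"
      proof (cases "a \<in> I")
        case True
        have "finite I" using I assms by (auto intro: finite_subset)
        then have "I - {a} \<in> ?X" using I True by auto
        moreover have "I = insert a (I - {a})" using True by auto
        ultimately show ?thesis by blast
      next
        case False
        then show ?thesis using I by auto
      qed
    qed
    show "?R \<subseteq> ?L"
    proof
      fix I assume "I \<in> ?R"
      then show "I \<in> ?L"
      proof
        assume "I \<in> insert a ` ?X"
        then obtain J where J: "J \<subseteq> A" "card J = k" "I = insert a J" by auto
        then have "finite J" "a \<notin> J" using assms by (auto intro: finite_subset)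
        then show ?thesis using J by auto
      qed auto
    qed
  qed
  have disj: "insert a ` ?X \<inter> ?Y = {}" using assms by auto
  have inj: "inj_on (insert a) ?X"
    using assms(2) by (intro inj_onI) (metis (mono_tags, lifting) insert_ident mem_Collect_eq subsetD)
  have "(\<Sum>I\<in>insert a ` ?X. prod v I) = (\<Sum>I\<in>?X. v a * prod v I)"
  proof (subst sum.reindex[OF inj], intro sum.cong refl)
    fix I assume "I \<in> ?X"
    then have "finite I" "a \<notin> I" using assms by (auto intro: finite_subset)
    then show "(prod v \<circ> insert a) I = v a * prod v I" by simp
  qed
  then show ?thesis
    unfolding sym_on_def split
    by (subst sum.union_disjoint) (use fin disj in \<open>auto simp: sum_distrib_left\<close>)
qed

lemma sym_on_remove:
  assumes "finite A" "a \<in> A"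
  shows "sym_on A (Suc k) v = v a * sym_on (A - {a}) k v + sym_on (A - {a}) (Suc k) v"
  using sym_on_insert[of "A - {a}" a k v] assms by (simp add: insert_absorb)

lemma sym_on_1: "finite A \<Longrightarrow> sym_on A 1 v = sum v A"
  by (induction A rule: finite_induct) (simp_all add: sym_on_insert)

text \<open>
  Euler's identity for homogeneous functions, as \<open>S\<^sub>k\<^sub>;\<^sub>i\<close> is the derivative of \<open>S\<^sub>k\<^sub>+\<^sub>1\<close> in the
  direction \<open>i\<close>.
\<close>
lemma sum_mult_sym_on_remove:
  assumes "finite A"
  shows "(\<Sum>i\<in>A. v i * sym_on (A - {i}) k v) = real (Suc k) * sym_on A (Suc k) v"
  using assms
proof (induction A arbitrary: k rule: finite_induct)
  case empty
  then show ?case by simp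
next
  case (insert a A)
  have "(\<Sum>i\<in>A. v i * sym_on (insert a A - {i}) k v)
      = (\<Sum>i\<in>A. v i * sym_on (insert a (A - {i})) k v)"
    using insert.hyps by (intro sum.cong refl arg_cong2[where f = "(*)"] arg_cong3[where f = sym_on]) auto
  also have "\<dots> = real k * v a * sym_on A k v + real (Suc k) * sym_on A (Suc k) v"
  proof (cases k)
    case 0
    then show ?thesis using insert.IH[of 0] insert.hyps by simp
  next
    case (Suc l)
    have "(\<Sum>i\<in>A. v i * sym_on (insert a (A - {i})) k v)
        = v a * (\<Sum>i\<in>A. v i * sym_on (A - {i}) l v) + (\<Sum>i\<in>A. v i * sym_on (A - {i}) k v)"
      using insert.hyps unfolding Suc
      by (simp add: sym_on_insert sum_distrib_left sum.distrib[symmetric] algebra_simps)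
    then show ?thesis using insert.IH Suc by (simp add: algebra_simps)
  qed
  finally show ?case using insert.hyps by (simp add: sym_on_insert algebra_simps)
qed

lemma elem_sym_eq: "elem_sym n k v = sym_on {1..n} k v"
  by (simp add: elem_sym_def sym_on_def)

lemma elem_sym_del_eq:
  assumes "i \<in> {1..n}"
  shows "elem_sym_del n k i v = sym_on ({1..n} - {i}) k v"
proof (cases k)
  case 0
  then show ?thesis by (simp add: elem_sym_del_def elem_sym_eq)
next
  case (Suc l)
  have "sym_on ({1..n} - {i}) k (v(i := 0)) = sym_on ({1..n} - {i}) k v"
    unfolding sym_on_def by (intro sum.cong prod.cong refl) auto
  then show ?thesis
    using sym_on_remove[of "{1..n}" i l "v(i := 0)"] assms Suc
    by (simp add: elem_sym_del_def elem_sym_eq)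
qed

section \<open>A Newton inequality and deletion of entries\<close>

text \<open>
  Expand \<open>(k+1) S\<^sub>k\<^sub>+\<^sub>1\<^sup>2 - (k+2) S\<^sub>k S\<^sub>k\<^sub>+\<^sub>2\<close> by writing \<open>(k+1) S\<^sub>k\<^sub>+\<^sub>1 = \<Sum>\<^sub>i x\<^sub>i S\<^sub>k\<^sub>;\<^sub>i\<close> and
  \<open>(k+2) S\<^sub>k\<^sub>+\<^sub>2 = \<Sum>\<^sub>i x\<^sub>i S\<^sub>k\<^sub>+\<^sub>1\<^sub>;\<^sub>i\<close> and splitting off \<open>x\<^sub>i\<close> from the other factor.  The mixed terms cancel,
  leaving \<open>\<Sum>\<^sub>i x\<^sub>i\<^sup>2 (S\<^sub>k\<^sub>;\<^sub>i\<^sup>2 - S\<^sub>k\<^sub>-\<^sub>1\<^sub>;\<^sub>i S\<^sub>k\<^sub>+\<^sub>1\<^sub>;\<^sub>i)\<close>, which is nonnegative by induction on \<open>k\<close>, whatever the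
  signs of the \<open>x\<^sub>i\<close>.
\<close>
lemma newton_strict:
  assumes "finite A"
  shows "real (k + 2) * (sym_on A k v * sym_on A (k + 2) v) \<le> real (k + 1) * (sym_on A (k + 1) v)\<^sup>2"
  using assms
proof (induction k arbitrary: A)
  case 0
  note fin = \<open>finite A\<close>
  have "(sym_on A 1 v)\<^sup>2 = (\<Sum>i\<in>A. v i * sym_on A 1 v)"
    using fin by (simp only: sym_on_1 power2_eq_square sum_distrib_right)
  also have "\<dots> = (\<Sum>i\<in>A. (v i)\<^sup>2 + v i * sym_on (A - {i}) 1 v)"
    using fin
    by (intro sum.cong refl) (simp add: sym_on_remove algebra_simps power2_eq_square)
  also have "\<dots> = (\<Sum>i\<in>A. (v i)\<^sup>2) + 2 * sym_on A 2 v"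
    using sum_mult_sym_on_remove[OF fin, of v 1] by (simp add: sum.distrib numeral_2_eq_2)
  finally show ?case using fin by (simp add: sum_nonneg numeral_2_eq_2)
next
  case (Suc k)
  note fin = \<open>finite A\<close>
  let ?e = "\<lambda>j. sym_on A j v" and ?d = "\<lambda>i j. sym_on (A - {i}) j v"
  have rem: "?e (Suc j) = v i * ?d i j + ?d i (Suc j)" if "i \<in> A" for i j
    using sym_on_remove[OF fin that] .
  have "real (k + 2) * (?e (k + 2))\<^sup>2 = (\<Sum>i\<in>A. v i * ?d i (k + 1)) * ?e (k + 2)"
    using sum_mult_sym_on_remove[OF fin, of v "k + 1"] by (simp add: power2_eq_square)
  also have "\<dots> = (\<Sum>i\<in>A. (v i)\<^sup>2 * (?d i (k + 1))\<^sup>2 + v i * (?d i (k + 1) * ?d i (k + 2)))"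
    unfolding sum_distrib_right
    by (intro sum.cong refl) (simp add: rem power2_eq_square algebra_simps)
  finally have sq: "real (k + 2) * (?e (k + 2))\<^sup>2 = \<dots>" .
  have "real (k + 3) * (?e (k + 1) * ?e (k + 3)) = (\<Sum>i\<in>A. v i * ?d i (k + 2)) * ?e (k + 1)"
    using sum_mult_sym_on_remove[OF fin, of v "k + 2"] by (simp add: eval_nat_numeral)
  also have "\<dots> = (\<Sum>i\<in>A. (v i)\<^sup>2 * (?d i k * ?d i (k + 2)) + v i * (?d i (k + 1) * ?d i (k + 2)))"
    unfolding sum_distrib_right
    by (intro sum.cong refl) (simp add: rem power2_eq_square algebra_simps)
  finally have mixed: "real (k + 3) * (?e (k + 1) * ?e (k + 3)) = \<dots>" .
  have weak: "?d i k * ?d i (k + 2) \<le> (?d i (k + 1))\<^sup>2" for i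
  proof -
    have "real (k + 2) * (?d i k * ?d i (k + 2)) \<le> real (k + 1) * (?d i (k + 1))\<^sup>2"
      using Suc.IH[of "A - {i}"] fin by simp
    also have "\<dots> \<le> real (k + 2) * (?d i (k + 1))\<^sup>2"
      by (intro mult_right_mono) auto
    finally show ?thesis by (simp del: of_nat_add)
  qed
  have "real (k + 3) * (?e (k + 1) * ?e (k + 3)) \<le> real (k + 2) * (?e (k + 2))\<^sup>2"
    unfolding sq mixed by (intro sum_mono add_right_mono mult_left_mono weak) auto
  then show ?case by (simp add: eval_nat_numeral)
qed

text \<open>
  Induction on the order.  Write \<open>a\<close>, \<open>b\<close>, \<open>d\<close> for three consecutive symmetric functions of the
  remaining entries and \<open>x\<close> for the deleted one.  If \<open>a > 0 \<ge> b\<close>, then \<open>x a + b > 0\<close> and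
  \<open>x b + d > 0\<close> would force \<open>a d > b\<^sup>2\<close>, contradicting the Newton inequality.
\<close>
lemma pos_upto_delete:
  assumes "finite A" "l \<in> A" "pos_upto A (Suc m) v"
  shows "pos_upto (A - {l}) m v"
proof -
  let ?d = "\<lambda>j. sym_on (A - {l}) j v"
  have "?d j > 0" if "j \<le> m" for j
    using that
  proof (induction j)
    case 0
    then show ?case using assms(1) by simp
  next
    case (Suc j)
    let ?x = "v l"
    have a: "?d j > 0" using Suc by simp
    have p: "?x * ?d j + ?d (Suc j) > 0" "?x * ?d (Suc j) + ?d (j + 2) > 0"
      using pos_uptoD[OF assms(3), of "Suc j"] pos_uptoD[OF assms(3), of "j + 2"] Suc.prems
        sym_on_remove[OF assms(1,2)] by (simp_all)
    have nw: "real (j + 2) * (?d j * ?d (j + 2)) \<le> real (j + 1) * (?d (Suc j))\<^sup>2"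
      using newton_strict[of "A - {l}" j v] assms(1) by simp
    show ?case
    proof (rule ccontr)
      assume "\<not> ?d (Suc j) > 0"
      then have b: "?d (Suc j) \<le> 0" by simp
      have "(?d (Suc j))\<^sup>2 \<le> (?x * ?d j) * (- ?d (Suc j))"
        using mult_right_mono[of "- ?d (Suc j)" "?x * ?d j" "- ?d (Suc j)"] p(1) b
        by (simp add: power2_eq_square)
      also have "\<dots> < ?d j * ?d (j + 2)"
        using mult_strict_left_mono[OF p(2) a] by (simp add: algebra_simps)
      finally have "(?d (Suc j))\<^sup>2 < ?d j * ?d (j + 2)" .
      then have "real (j + 2) * (?d (Suc j))\<^sup>2 < real (j + 2) * (?d j * ?d (j + 2))"
        by (intro mult_strict_left_mono) auto
      moreover have "real (j + 1) * (?d (Suc j))\<^sup>2 \<le> real (j + 2) * (?d (Suc j))\<^sup>2"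
        by (intro mult_right_mono) auto
      ultimately show False using nw by linarith
    qed
  qed
  then show ?thesis by (auto simp: pos_upto_def)
qed

lemma pos_upto_Diff:
  assumes "finite A" "F \<subseteq> A" "pos_upto A (m + card F) v"
  shows "pos_upto (A - F) m v"
proof -
  have "finite F" using assms finite_subset by blast
  then show ?thesis using assms
  proof (induction F arbitrary: m rule: finite_induct)
    case empty
    then show ?case by simp
  next
    case (insert x F)
    have "pos_upto (A - F) (Suc m) v" using insert by simp
    then have "pos_upto (A - F - {x}) m v"
      using insert by (intro pos_upto_delete) auto
    then show ?case by (simp add: Diff_insert[symmetric])
  qed
qed

section \<open>The dichotomy and the product bound\<close>

text \<open>
  The step from \<open>k\<close> to \<open>k+1\<close> entries costs a factor \<open>k+2\<close>, the gap below 1 in the Newton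
  inequality being \<open>1/(k+2)\<close>, and a factor 2, for halving the threshold that separates the two cases.
\<close>
definition dich_const :: "nat \<Rightarrow> real" where
  "dich_const k = 1 / (2 ^ k * fact (k + 1))"

lemma dich_const_pos [simp]: "dich_const k > 0"
  by (simp add: dich_const_def)

lemma dich_const_Suc: "dich_const (Suc k) = dich_const k / (2 * real (k + 2))"
  by (simp add: dich_const_def field_simps)

text \<open>
  Induction on the number of selected entries.  Delete a selected entry \<open>x\<close>, and let \<open>a\<close>, \<open>b\<close>, \<open>d\<close> be
  the symmetric functions of orders \<open>k\<close>, \<open>k+1\<close>, \<open>k+2\<close> of the remaining entries.  Unless \<open>x a + b\<close> is
  large, both alternatives of the induction hypothesis make \<open>b\<close> negative of the right size.  The
  Newton inequality, with its constant below 1, then shows that \<open>d\<close> cannot compensate \<open>x b\<close>: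
  from \<open>\<bar>b\<bar> < x a\<close> one gets \<open>d \<le> (k+1)/(k+2) x \<bar>b\<bar>\<close>, hence \<open>x b + d \<le> x b / (k+2)\<close>.
\<close>
lemma sym_dichotomy:
  assumes "finite A" "T \<subseteq> A" "pos_upto A (card T) v"
    and "\<And>t. t \<in> T \<Longrightarrow> 0 < v t" "\<And>t. t \<in> T \<Longrightarrow> q \<le> v t" "0 \<le> q"
  shows "dich_const (card T) * prod v T \<le> sym_on A (card T) v \<or>
         sym_on A (Suc (card T)) v \<le> - (dich_const (card T) * prod v T * q)"
proof -
  have "finite T" using assms finite_subset by blast
  then show ?thesis using assms
  proof (induction T arbitrary: A rule: finite_induct)
    case empty
    then show ?case by (simp add: dich_const_def)
  next
    case (insert t T)
    define k where "k = card T"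
    have ck: "card (insert t T) = Suc k" using insert by (simp add: k_def)
    let ?B = "A - {t}"
    define x where "x = v t"
    define a where "a = sym_on ?B k v"
    define b where "b = sym_on ?B (k + 1) v"
    define d where "d = sym_on ?B (k + 2) v"
    define c where "c = dich_const k"
    define P where "P = prod v T"
    have x: "x > 0" "q \<le> x" using insert by (auto simp: x_def)
    have c: "c > 0" by (simp add: c_def)
    have P: "P > 0" unfolding P_def using insert by (intro prod_pos) auto
    have tA: "t \<in> A" "T \<subseteq> ?B" using insert by auto
    have posB: "pos_upto ?B k v"
      using pos_upto_delete[of A t k v] insert.prems tA ck by simp
    have a: "a > 0"
      using pos_uptoD[OF posB, of k] insert.prems by (cases k) (auto simp: a_def)
    have Sk: "sym_on A (Suc k) v = x * a + b" "sym_on A (Suc (Suc k)) v = x * b + d"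
      using sym_on_remove[OF \<open>finite A\<close> tA(1)] by (simp_all add: x_def a_def b_def d_def)
    have pos: "x * a + b > 0"
      using pos_uptoD[OF insert.prems(3), of "Suc k"] ck Sk by simp
    have IH: "c * P \<le> a \<or> b \<le> - (c * P * q)"
      using insert.IH[of ?B] insert.prems tA posB unfolding k_def a_def b_def c_def P_def by simp
    have nw: "real (k + 2) * (a * d) \<le> real (k + 1) * b\<^sup>2"
      using newton_strict[of ?B] insert.prems unfolding a_def b_def d_def by blast
    have key: "x * b + d \<le> x * b / real (k + 2)" if "b \<le> 0"
    proof -
      have "b\<^sup>2 \<le> (x * a) * (- b)"
        using mult_right_mono[of "- b" "x * a" "- b"] pos that by (simp add: power2_eq_square)
      then have "real (k + 1) * b\<^sup>2 \<le> real (k + 1) * ((x * a) * (- b))"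
        by (intro mult_left_mono) auto
      with nw have "a * (real (k + 2) * d) \<le> a * (real (k + 1) * (x * (- b)))"
        by (simp add: algebra_simps)
      then have "real (k + 2) * d \<le> real (k + 1) * (x * (- b))"
        using a by (simp only: mult_le_cancel_left_pos)
      then show ?thesis by (simp add: field_simps)
    qed
    have second: "x * b + d \<le> - (c / (2 * real (k + 2)) * (x * P) * q)"
      if b: "b \<le> - (c / 2 * P * q)"
    proof -
      have "c / 2 * P * q \<ge> 0" using c P insert.prems(6) by simp
      then have "b \<le> 0" using b by linarith
      have "x * b \<le> x * (- (c / 2 * P * q))" using b x by (intro mult_left_mono) auto
      then have "x * b / real (k + 2) \<le> x * (- (c / 2 * P * q)) / real (k + 2)"
        by (intro divide_right_mono) auto
      also have "\<dots> = - (c / (2 * real (k + 2)) * (x * P) * q)" by (simp add: field_simps)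
      finally show ?thesis using key[OF \<open>b \<le> 0\<close>] by linarith
    qed
    have "c / (2 * real (k + 2)) * (x * P) \<le> c / 2 * (x * P)"
      using c P x by (intro mult_right_mono) (auto simp: field_simps)
    also have "\<dots> = (c * P * x) / 2" by simp
    finally have shrink: "c / (2 * real (k + 2)) * (x * P) \<le> (c * P * x) / 2" .
    have "c / (2 * real (k + 2)) * (x * P) \<le> x * a + b
        \<or> x * b + d \<le> - (c / (2 * real (k + 2)) * (x * P) * q)"
    proof (rule disjCI)
      assume "\<not> x * b + d \<le> - (c / (2 * real (k + 2)) * (x * P) * q)"
      then have b: "b > - (c / 2 * P * q)" using second by force
      have cPq: "0 \<le> c * P * q" using c P insert.prems(6) by simp
      then have "c * P \<le> a" using IH b by (auto simp: algebra_simps)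
      then have "c * P * x \<le> x * a" using x mult_left_mono[of "c * P" a x] by (simp add: mult_ac)
      moreover have "c / 2 * P * q \<le> (c * P * x) / 2"
        using c P x by simp
      ultimately show "c / (2 * real (k + 2)) * (x * P) \<le> x * a + b"
        using b shrink by linarith
    qed
    moreover have "prod v (insert t T) = x * P"
      using insert.hyps by (simp add: x_def P_def)
    ultimately show ?case
      unfolding ck Sk dich_const_Suc c_def[symmetric] by simp
  qed
qed

corollary sym_on_ge_prod:
  assumes "finite A" "T \<subseteq> A" "pos_upto A (Suc (card T)) v" "\<And>t. t \<in> T \<Longrightarrow> 0 < v t"
  shows "dich_const (card T) * prod v T \<le> sym_on A (card T) v"
proof -
  have "pos_upto A (card T) v" using assms(3) by (auto simp: pos_upto_def)
  then have "dich_const (card T) * prod v T \<le> sym_on A (card T) v \<or> sym_on A (Suc (card T)) v \<le> 0"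
    using sym_dichotomy[of A T v 0] assms by (simp add: less_imp_le)
  moreover have "sym_on A (Suc (card T)) v > 0"
    using pos_uptoD[OF assms(3)] by simp
  ultimately show ?thesis by linarith
qed

text \<open>
  The only way for the first factor to be much smaller than the product \<open>P\<close> of the selected entries
  is the second alternative of the dichotomy with a large deleted entry \<open>v l\<close>; then the second factor
  exceeds \<open>P\<close> correspondingly, as one sees by exchanging the smallest selected entry for \<open>v l\<close>.
\<close>
lemma prod_sq_le_sym_mult:
  assumes "finite A" "l \<in> A" "T \<subseteq> A - {l}" "pos_upto A (Suc (card T)) v"
    and posT: "\<And>t. t \<in> T \<Longrightarrow> 0 < v t"
  shows "(dich_const (card T) * prod v T)\<^sup>2
    \<le> sym_on (A - {l}) (card T) v * sym_on A (card T) v"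
proof (cases "T = {}")
  case True
  then show ?thesis using assms(1) by (simp add: dich_const_def)
next
  case False
  define k where "k = card T"
  define c where "c = dich_const k"
  define P where "P = prod v T"
  define y where "y = sym_on (A - {l}) k v"
  define z where "z = sym_on A k v"
  have finT: "finite T" using finite_subset[OF assms(3)] assms(1) by simp
  have c: "c > 0" by (simp add: c_def)
  have P: "P > 0" unfolding P_def using posT by (intro prod_pos) auto
  have posB: "pos_upto (A - {l}) k v" using pos_upto_delete[OF assms(1,2,4)] unfolding k_def .
  have k1: "k \<ge> 1" using False finT by (simp add: k_def Suc_le_eq card_gt_0_iff)
  have y: "y > 0" using pos_uptoD[OF posB, of k] k1 by (simp add: y_def)
  have z: "c * P \<le> z"
    unfolding c_def P_def z_def k_def using assms by (intro sym_on_ge_prod) auto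
  have done_if: "(c * P)\<^sup>2 \<le> y * z" if "c * P \<le> y"
    using mult_mono[OF that z] y c P by (simp add: power2_eq_square)
  obtain s where s: "s \<in> T" "\<And>t. t \<in> T \<Longrightarrow> v s \<le> v t"
    using arg_min_if_finite[OF finT False, of v] by (meson not_le_imp_less)
  define q where "q = v s"
  have q: "q > 0" using s posT by (simp add: q_def)
  have "c * P \<le> y \<or> sym_on (A - {l}) (Suc k) v \<le> - (c * P * q)"
    unfolding c_def P_def y_def k_def
    using assms(1,3) posB posT s(2) q
    by (intro sym_dichotomy) (simp_all add: k_def q_def)
  then have "(c * P)\<^sup>2 \<le> y * z"
  proof
    assume neg: "sym_on (A - {l}) (Suc k) v \<le> - (c * P * q)"
    have "0 < v l * y + sym_on (A - {l}) (Suc k) v"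
      using pos_uptoD[OF assms(4), of "Suc k"] sym_on_remove[OF assms(1,2), of k v]
      by (simp add: k_def y_def)
    then have big: "c * P * q < v l * y" using neg by simp
    show ?thesis
    proof (cases "v l \<le> q")
      case True
      then have "v l * y \<le> q * y" using y by (intro mult_right_mono) auto
      then have "q * (c * P) \<le> q * y" using big by (simp add: algebra_simps)
      then show ?thesis using q done_if by simp
    next
      case False
      then have vl: "v l > 0" using q by simp
      let ?T' = "insert l (T - {s})"
      have lT: "l \<notin> T" using assms(3) by auto
      have card': "card ?T' = k"
        using lT finT s(1) k1 by (simp add: k_def)
      have prod': "prod v ?T' * q = v l * P"
        using lT finT s(1) prod.remove[OF finT s(1), of v] by (simp add: P_def q_def)
      have "dich_const (card ?T') * prod v ?T' \<le> sym_on A (card ?T') v"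
      proof (rule sym_on_ge_prod)
        show "pos_upto A (Suc (card ?T')) v" using assms(4) unfolding card' k_def .
        show "0 < v t" if "t \<in> ?T'" for t using that vl posT by blast
      qed (use assms(1-3) in auto)
      then have "c * prod v ?T' \<le> z" unfolding card' c_def z_def .
      then have "c * prod v ?T' * q \<le> z * q" using q by (intro mult_right_mono) auto
      then have exch: "c * (v l * P) \<le> z * q" using prod' by (simp only: mult.assoc)
      have "(c * P * q) * (c * (v l * P)) \<le> (v l * y) * (z * q)"
        using c P vl y by (intro mult_mono[OF less_imp_le[OF big] exch]) simp_all
      then have "(v l * q) * (c * P)\<^sup>2 \<le> (v l * q) * (y * z)"
        by (simp only: power2_eq_square mult_ac)
      then show ?thesis using mult_pos_pos[OF vl q] by (simp only: mult_le_cancel_left_pos)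
    qed
  qed (rule done_if)
  then show ?thesis unfolding c_def P_def y_def z_def k_def .
qed

corollary prod_le_sqrt_sym_mult:
  assumes "finite A" "l \<in> A" "T \<subseteq> A - {l}" "pos_upto A (Suc (card T)) v"
    and "\<And>t. t \<in> T \<Longrightarrow> 0 < v t"
  shows "prod v T \<le> 1 / dich_const (card T)
    * sqrt (sym_on (A - {l}) (card T) v * sym_on A (card T) v)"
proof -
  have "dich_const (card T) * prod v T
      \<le> sqrt (sym_on (A - {l}) (card T) v * sym_on A (card T) v)"
    by (intro real_le_rsqrt prod_sq_le_sym_mult assms)
  then show ?thesis by (simp add: field_simps)
qed

section \<open>Ordered vectors\<close>

lemma prod_abs_le_power_mult_prod:
  fixes v :: "'a \<Rightarrow> real"
  assumes "finite J" "finite T" "card J = card T" "1 \<le> K"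
    and pos: "\<And>t. t \<in> T \<Longrightarrow> 0 < v t"
    and le: "\<And>j t. j \<in> J - T \<Longrightarrow> t \<in> T \<Longrightarrow> \<bar>v j\<bar> \<le> K * v t"
  shows "(\<Prod>j\<in>J. \<bar>v j\<bar>) \<le> K ^ card T * prod v T"
proof -
  have card: "card (J - T) = card (T - J)"
    using assms(1-3) by (metis card_Diff_subset_Int finite_Int inf_commute)
  then obtain g where g: "bij_betw g (J - T) (T - J)"
    using finite_same_card_bij[of "J - T" "T - J"] assms by auto
  have "(\<Prod>j\<in>J - T. \<bar>v j\<bar>) \<le> (\<Prod>j\<in>J - T. K * v (g j))"
    using g le by (intro prod_mono) (auto simp: bij_betw_def)
  also have "\<dots> = K ^ card (T - J) * prod v (T - J)"
    using prod.reindex_bij_betw[OF g, of v] by (simp add: prod.distrib card)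
  also have "\<dots> \<le> K ^ card T * prod v (T - J)"
    using assms by (intro mult_right_mono power_increasing card_mono prod_nonneg)
      (auto intro: less_imp_le)
  finally have "(\<Prod>j\<in>J - T. \<bar>v j\<bar>) \<le> K ^ card T * prod v (T - J)" .
  moreover have "(\<Prod>j\<in>J \<inter> T. \<bar>v j\<bar>) = prod v (J \<inter> T)"
    using pos by (intro prod.cong refl abs_of_pos) auto
  moreover have "prod v (J \<inter> T) \<ge> 0"
    using pos by (intro prod_nonneg) (auto intro: less_imp_le)
  ultimately have "(\<Prod>j\<in>J \<inter> T. \<bar>v j\<bar>) * (\<Prod>j\<in>J - T. \<bar>v j\<bar>)
      \<le> prod v (J \<inter> T) * (K ^ card T * prod v (T - J))"
    by (intro mult_mono) (simp_all add: prod_nonneg)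
  moreover have "(\<Prod>j\<in>J. \<bar>v j\<bar>) = (\<Prod>j\<in>J \<inter> T. \<bar>v j\<bar>) * (\<Prod>j\<in>J - T. \<bar>v j\<bar>)"
    using assms(1) by (rule prod.Int_Diff)
  moreover have "prod v T = prod v (J \<inter> T) * prod v (T - J)"
    using prod.Int_Diff[OF assms(2), of v J] by (simp add: Int_commute)
  ultimately show ?thesis by (simp add: algebra_simps)
qed

text \<open>
  After deletion of the entries \<open>1, \<dots>, m-1\<close> the remaining ones have positive sum, and none of them
  exceeds \<open>v m\<close>; so \<open>v m\<close> is positive, and a negative one is balanced by the others.
\<close>
lemma tail_bound:
  fixes v :: "nat \<Rightarrow> real"
  assumes "1 \<le> m" "m \<le> n" "pos_upto {1..n} m v" "antimono_on {1..n} v"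
  shows "0 < v m" and "\<And>j. m \<le> j \<Longrightarrow> j \<le> n \<Longrightarrow> \<bar>v j\<bar> \<le> real n * v m"
proof -
  have "pos_upto ({1..n} - {1..m - 1}) 1 v"
    using assms by (intro pos_upto_Diff) auto
  moreover have "{1..n} - {1..m - 1} = {m..n}" using assms by auto
  ultimately have "sym_on {m..n} 1 v > 0" by (simp add: pos_upto_def)
  then have sum: "sum v {m..n} > 0" using sym_on_1[of "{m..n}" v] by simp
  have le: "v j \<le> v m" if "m \<le> j" "j \<le> n" for j
    using assms that by (auto simp: monotone_on_def)
  have "sum v {m..n} \<le> real (card {m..n}) * v m"
    using le by (intro sum_bounded_above) auto
  then have "real (card {m..n}) * v m > 0" using sum by linarith
  then show vm: "v m > 0" by (simp add: zero_less_mult_iff)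
  fix j assume j: "m \<le> j" "j \<le> n"
  have "sum v ({m..n} - {j}) \<le> real (card ({m..n} - {j})) * v m"
    using le by (intro sum_bounded_above) auto
  also have "\<dots> \<le> real n * v m"
    using vm j assms by (intro mult_right_mono) auto
  finally have "- v j \<le> real n * v m"
    using sum sum.remove[of "{m..n}" j v] j by simp
  moreover have "v j \<le> real n * v m"
  proof -
    have "1 * v m \<le> real n * v m" using vm assms by (intro mult_right_mono) auto
    then show ?thesis using le[OF j] by simp
  qed
  ultimately show "\<bar>v j\<bar> \<le> real n * v m" by simp
qed

theorem lemma2p2:
  fixes n m :: nat
  assumes "1 \<le> m" and "m \<le> n"
  shows "\<exists>C::real. \<forall>v\<in>Gamma_cone n m. antimono_on {1..n} v \<longrightarrow>
    (\<forall>i\<in>{1..m - 1}.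
        (\<Prod>j\<in>{1..m}. v j) / v i
          \<le> C * sqrt (elem_sym_del n (m - 1) i v * elem_sym n (m - 1) v)) \<and>
    (\<forall>l\<in>{1..n}. \<forall>ix::nat \<Rightarrow> nat.
        strict_mono_on {1..m - 1} ix \<longrightarrow>
        (\<forall>s\<in>{1..m - 1}. ix s \<in> {1..n} \<and> ix s \<noteq> l) \<longrightarrow>
        (\<Prod>s\<in>{1..m - 1}. \<bar>v (ix s)\<bar>)
          \<le> C * sqrt (elem_sym_del n (m - 1) l v * elem_sym n (m - 1) v))"
proof -
  define D where "D = 1 / dich_const (m - 1)"
  define C where "C = real n ^ (m - 1) * D"
  have n1: "real n \<ge> 1" using assms by simp
  have D: "D > 0" by (simp add: D_def)
  have DC: "D \<le> C" using mult_right_mono[of 1 "real n ^ (m - 1)" D] n1 D by (simp add: C_def)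
  show ?thesis
  proof (intro exI[of _ C] ballI impI)
    fix v assume v: "v \<in> Gamma_cone n m" and mono: "antimono_on {1..n} v"
    have pos: "pos_upto {1..n} m v"
      using v by (simp add: Gamma_cone_def pos_upto_def elem_sym_eq)
    note tail = tail_bound[OF assms pos mono]
    have ge: "v m \<le> v t" if "t \<in> {1..m}" for t
      using mono that assms by (auto simp: monotone_on_def)
    have post: "0 < v t" if "t \<in> {1..m}" for t
      using ge[OF that] tail(1) by simp
    define R where "R l = sqrt (elem_sym_del n (m - 1) l v * elem_sym n (m - 1) v)" for l
    have main: "prod v T \<le> D * R l"
      if "l \<in> {1..n}" "T \<subseteq> {1..m}" "l \<notin> T" "card T = m - 1" for l T
    proof -
      have "T \<subseteq> {1..n} - {l}" using that assms by fastforce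
      then show ?thesis
        using prod_le_sqrt_sym_mult[of "{1..n}" l T v] that post pos assms(1)
        unfolding R_def D_def elem_sym_del_eq[OF that(1)] elem_sym_eq by (simp add: subset_iff)
    qed
    have partA: "(\<Prod>j\<in>{1..m}. v j) / v i \<le> C * R i" if i: "i \<in> {1..m - 1}" for i
    proof -
      have im: "i \<in> {1..m}" using i by auto
      have "(\<Prod>j\<in>{1..m}. v j) / v i = prod v ({1..m} - {i})"
        using prod.remove[of "{1..m}" i v] im post[OF im] by simp
      also have DR: "\<dots> \<le> D * R i"
        using im assms by (intro main) auto
      also have "D * R i \<le> C * R i"
      proof -
        have "0 < prod v ({1..m} - {i})" using post by (intro prod_pos) auto
        then have "0 < D * R i" using DR by linarith
        then have "0 \<le> R i" using D by (simp add: zero_less_mult_iff)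
        then show ?thesis using DC by (intro mult_right_mono)
      qed
      finally show ?thesis .
    qed
    have partB: "(\<Prod>s\<in>{1..m - 1}. \<bar>v (ix s)\<bar>) \<le> C * R l"
      if l: "l \<in> {1..n}" and ix: "strict_mono_on {1..m - 1} ix"
        and rng: "\<forall>s\<in>{1..m - 1}. ix s \<in> {1..n} \<and> ix s \<noteq> l" for l and ix :: "nat \<Rightarrow> nat"
    proof -
      define J where "J = ix ` {1..m - 1}"
      \<comment> \<open>the positions of the \<open>m - 1\<close> largest entries once entry \<open>l\<close> is deleted\<close>
      define T where "T = (if l \<le> m then {1..m} - {l} else {1..m - 1})"
      have inj: "inj_on ix {1..m - 1}" using ix by (rule strict_mono_on_imp_inj_on)
      have J: "finite J" "card J = m - 1" "J \<subseteq> {1..n} - {l}"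
        using inj rng by (auto simp: J_def card_image)
      have T: "finite T" "card T = m - 1" "T \<subseteq> {1..m}" "l \<notin> T" "{1..<m} - {l} \<subseteq> T"
        using l assms by (auto simp: T_def)
      have "(\<Prod>s\<in>{1..m - 1}. \<bar>v (ix s)\<bar>) = (\<Prod>j\<in>J. \<bar>v j\<bar>)"
        unfolding J_def using inj by (simp add: prod.reindex)
      also have "\<dots> \<le> real n ^ card T * prod v T"
      proof (rule prod_abs_le_power_mult_prod)
        fix j t assume j: "j \<in> J - T" and t: "t \<in> T"
        have "j \<in> {1..n}" "j \<noteq> l" "j \<notin> T" using J(3) j by auto
        then have "m \<le> j" "j \<le> n" using T(5) by (fastforce simp: not_le)+
        then have "\<bar>v j\<bar> \<le> real n * v m" by (rule tail(2))
        also have "\<dots> \<le> real n * v t" using ge[of t] t T(3) by (intro mult_left_mono) auto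
        finally show "\<bar>v j\<bar> \<le> real n * v t" .
      qed (use J T n1 post in auto)
      also have "\<dots> \<le> real n ^ card T * (D * R l)"
        using main[of l T] T l by (intro mult_left_mono) auto
      finally show ?thesis by (simp add: C_def T mult.assoc)
    qed
    show "(\<forall>i\<in>{1..m - 1}.
        (\<Prod>j\<in>{1..m}. v j) / v i
          \<le> C * sqrt (elem_sym_del n (m - 1) i v * elem_sym n (m - 1) v)) \<and>
      (\<forall>l\<in>{1..n}. \<forall>ix::nat \<Rightarrow> nat.
        strict_mono_on {1..m - 1} ix \<longrightarrow>
        (\<forall>s\<in>{1..m - 1}. ix s \<in> {1..n} \<and> ix s \<noteq> l) \<longrightarrow>
        (\<Prod>s\<in>{1..m - 1}. \<bar>v (ix s)\<bar>)
          \<le> C * sqrt (elem_sym_del n (m - 1) l v * elem_sym n (m - 1) v))"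
      using partA partB unfolding R_def by blast
  qed
qed

end
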